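(* Let $X=X_T$ be the binary tree space and let $\Pi$ be the set of all strongly exposed points of $B_X$. Then $\Pi$ is generating for $B_X$. In particular, $B_X$ is dentable, hence SCD.
   Context: Binary tree space: $T=\{\emptyset\}\cup\bigcup_{n\in\mathbb{N}}\{0,1\}^n$ is the infinite binary tree of finite $0$-$1$ sequences, ordered by $s\preceq t$ iff $s$ is an initial segment of $t$. A chain is a non-empty (totally, hence well) ordered subset of $T$; $\mathcal{A}$ is the collection of all chains. $X=X_T$ is the real Banach space obtained by completing the space $c_{00}(T)$ of finitely supported real functions on $T$ for the norm $\|x\|=\sup_{A\in\mathcal{A}}\sum_{t\in A}|x(t)|$. $B_X$ is its closed unit ball. Let $A$ be a bounded non-empty subset of a real Banach space $X$. A point $x\in A$ is strongly exposed if there is $f\in X^*$ such that for all sequences $(x_n)\subseteq A$, $f(x_n)\to f(x)$ if and only if $x_n\to x$ in norm. A slice of $A$ is a set $\{x\in A\colon f(x)>\sup f(A)-\delta\}$ with $f\in X^*$, $\delta>0$. A point of $A$ is a denting point if it is contained in slices of $A$ of arbitrarily small diameter. A subset $G\subseteq A$ is generating for $A$ if $A\subseteq\overline{\mathrm{conv}}(G)$. $A$ is dentable if the set of its denting points is generating for $A$. A collection $\{A_i\}_{i\in I}$ of non-empty subsets of $A$ is determining for $A$ if $A\subseteq\overline{\mathrm{conv}}\{x_i\colon i\in I\}$ for every $(x_i)_{i\in I}\in\prod_{i\in I}A_i$. $A$ is SCD (slicely countably determined) if it admits a countable determining collection of slices. *)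

theory Defs
  imports "HOL-Analysis.Analysis" "HOL-Library.Sublist"
begin

section \<open>Completion of a real normed space\<close>

text \<open>Cauchy sequences modulo null sequences.\<close>

definition cauchy_rel :: "(nat \<Rightarrow> 'a::real_normed_vector) \<Rightarrow> (nat \<Rightarrow> 'a) \<Rightarrow> bool" where
  "cauchy_rel x y \<longleftrightarrow> Cauchy x \<and> Cauchy y \<and> (\<lambda>n. x n - y n) \<longlonglongrightarrow> 0"

lemma cauchy_rel_part_equivp: "part_equivp (cauchy_rel :: (nat \<Rightarrow> 'a::real_normed_vector) \<Rightarrow> _)"
proof (rule part_equivpI)
  show "\<exists>x::nat \<Rightarrow> 'a. cauchy_rel x x"
    by (rule exI[of _ "\<lambda>_. 0"]) (simp add: cauchy_rel_def convergent_Cauchy convergent_const)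
  show "symp (cauchy_rel :: (nat \<Rightarrow> 'a) \<Rightarrow> _)"
  proof (rule sympI)
    fix x y :: "nat \<Rightarrow> 'a" assume "cauchy_rel x y"
    then show "cauchy_rel y x"
      unfolding cauchy_rel_def using tendsto_minus[of "\<lambda>n. x n - y n" 0 sequentially] by simp
  qed
  show "transp (cauchy_rel :: (nat \<Rightarrow> 'a) \<Rightarrow> _)"
  proof (rule transpI)
    fix x y z :: "nat \<Rightarrow> 'a" assume "cauchy_rel x y" "cauchy_rel y z"
    then show "cauchy_rel x z"
      unfolding cauchy_rel_def
      using tendsto_add[of "\<lambda>n. x n - y n" 0 sequentially "\<lambda>n. y n - z n" 0] by simp
  qed
qed

quotient_type (overloaded) 'a banach_completion =
  "nat \<Rightarrow> 'a::real_normed_vector" / partial: cauchy_rel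
  by (rule cauchy_rel_part_equivp)

lemma Cauchy_norm_seq:
  fixes x :: "nat \<Rightarrow> 'a::real_normed_vector"
  assumes "Cauchy x" shows "Cauchy (\<lambda>n. norm (x n))"
proof (rule metric_CauchyI)
  fix e :: real assume "0 < e"
  then obtain M where M: "\<forall>m\<ge>M. \<forall>n\<ge>M. dist (x m) (x n) < e"
    using assms metric_CauchyD by blast
  have "dist (norm (x m)) (norm (x n)) \<le> dist (x m) (x n)" for m n
    by (simp add: dist_norm norm_triangle_ineq3)
  with M show "\<exists>M. \<forall>m\<ge>M. \<forall>n\<ge>M. dist (norm (x m)) (norm (x n)) < e"
    by (meson le_less_trans)
qed

lemma Cauchy_scaleR_seq:
  fixes x :: "nat \<Rightarrow> 'a::real_normed_vector"
  shows "Cauchy x \<Longrightarrow> Cauchy (\<lambda>n. r *\<^sub>R x n)"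
  by (rule bounded_linear.Cauchy[OF bounded_linear_scaleR_right])

lemma Cauchy_add_seq:
  fixes x y :: "nat \<Rightarrow> 'a::real_normed_vector"
  assumes "Cauchy x" "Cauchy y" shows "Cauchy (\<lambda>n. x n + y n)"
proof (rule metric_CauchyI)
  fix e :: real assume "0 < e"
  then have e: "0 < e/2" by simp
  obtain M where M: "\<forall>m\<ge>M. \<forall>n\<ge>M. dist (x m) (x n) < e/2"
    using metric_CauchyD[OF assms(1) e] by blast
  obtain N where N: "\<forall>m\<ge>N. \<forall>n\<ge>N. dist (y m) (y n) < e/2"
    using metric_CauchyD[OF assms(2) e] by blast
  have "dist (x m + y m) (x n + y n) < e" if "m \<ge> max M N" "n \<ge> max M N" for m n
  proof -
    have "dist (x m) (x n) < e/2" "dist (y m) (y n) < e/2" using M N that by auto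
    then show ?thesis using dist_triangle_add[of "x m" "y m" "x n" "y n"] by linarith
  qed
  then show "\<exists>M. \<forall>m\<ge>M. \<forall>n\<ge>M. dist (x m + y m) (x n + y n) < e" by blast
qed

lemma Cauchy_minus_seq:
  fixes x :: "nat \<Rightarrow> 'a::real_normed_vector"
  shows "Cauchy x \<Longrightarrow> Cauchy (\<lambda>n. - x n)"
  using Cauchy_scaleR_seq[of x "-1"] by simp

lemma Cauchy_diff_seq:
  fixes x y :: "nat \<Rightarrow> 'a::real_normed_vector"
  assumes "Cauchy x" "Cauchy y" shows "Cauchy (\<lambda>n. x n - y n)"
  using Cauchy_add_seq[OF assms(1) Cauchy_minus_seq[OF assms(2)]] by simp

lemma norm_seq_tendsto:
  fixes x :: "nat \<Rightarrow> 'a::real_normed_vector"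
  assumes "Cauchy x" shows "(\<lambda>n. norm (x n)) \<longlonglongrightarrow> lim (\<lambda>n. norm (x n))"
  using Cauchy_norm_seq[OF assms] Cauchy_convergent convergent_LIMSEQ_iff by blast

lemma cauchy_rel_lim_norm:
  assumes "cauchy_rel x y"
  shows "lim (\<lambda>n. norm (x n)) = lim (\<lambda>n. norm (y n))"
proof -
  have c: "Cauchy x" "Cauchy y" and d: "(\<lambda>n. x n - y n) \<longlonglongrightarrow> 0"
    using assms by (auto simp: cauchy_rel_def)
  have "(\<lambda>n. norm (x n) - norm (y n)) \<longlonglongrightarrow> 0"
    by (rule Lim_null_comparison[OF _ tendsto_norm_zero[OF d]])
      (simp add: norm_triangle_ineq3)
  moreover have "(\<lambda>n. norm (x n) - norm (y n)) \<longlonglongrightarrow>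
      lim (\<lambda>n. norm (x n)) - lim (\<lambda>n. norm (y n))"
    by (intro tendsto_diff norm_seq_tendsto c)
  ultimately show ?thesis using LIMSEQ_unique by fastforce
qed

instantiation banach_completion :: (real_normed_vector) real_normed_vector
begin

lift_definition zero_banach_completion :: "'a banach_completion" is "\<lambda>_. 0"
  by (simp add: cauchy_rel_def convergent_Cauchy convergent_const)

lift_definition plus_banach_completion ::
    "'a banach_completion \<Rightarrow> 'a banach_completion \<Rightarrow> 'a banach_completion"
  is "\<lambda>x y n. x n + y n"
proof -
  fix x x' y y' :: "nat \<Rightarrow> 'a" assume "cauchy_rel x x'" "cauchy_rel y y'"
  then show "cauchy_rel (\<lambda>n. x n + y n) (\<lambda>n. x' n + y' n)"
    using tendsto_add[of "\<lambda>n. x n - x' n" 0 sequentially "\<lambda>n. y n - y' n" 0]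
    by (simp add: cauchy_rel_def Cauchy_add_seq algebra_simps)
qed

lift_definition minus_banach_completion ::
    "'a banach_completion \<Rightarrow> 'a banach_completion \<Rightarrow> 'a banach_completion"
  is "\<lambda>x y n. x n - y n"
proof -
  fix x x' y y' :: "nat \<Rightarrow> 'a" assume "cauchy_rel x x'" "cauchy_rel y y'"
  then show "cauchy_rel (\<lambda>n. x n - y n) (\<lambda>n. x' n - y' n)"
    using tendsto_diff[of "\<lambda>n. x n - x' n" 0 sequentially "\<lambda>n. y n - y' n" 0]
    by (simp add: cauchy_rel_def Cauchy_diff_seq algebra_simps)
qed

lift_definition uminus_banach_completion :: "'a banach_completion \<Rightarrow> 'a banach_completion"
  is "\<lambda>x n. - x n"
proof -
  fix x x' :: "nat \<Rightarrow> 'a" assume "cauchy_rel x x'"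
  then show "cauchy_rel (\<lambda>n. - x n) (\<lambda>n. - x' n)"
    using tendsto_minus[of "\<lambda>n. x n - x' n" 0 sequentially]
    by (simp add: cauchy_rel_def Cauchy_minus_seq)
qed

lift_definition scaleR_banach_completion ::
    "real \<Rightarrow> 'a banach_completion \<Rightarrow> 'a banach_completion"
  is "\<lambda>r x n. r *\<^sub>R x n"
proof -
  fix r and x x' :: "nat \<Rightarrow> 'a" assume "cauchy_rel x x'"
  then show "cauchy_rel (\<lambda>n. r *\<^sub>R x n) (\<lambda>n. r *\<^sub>R x' n)"
    using tendsto_scaleR[OF tendsto_const, of "\<lambda>n. x n - x' n" 0 sequentially r]
    by (simp add: cauchy_rel_def Cauchy_scaleR_seq scaleR_diff_right)
qed

lift_definition norm_banach_completion :: "'a banach_completion \<Rightarrow> real"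
  is "\<lambda>x. lim (\<lambda>n. norm (x n))"
  by (rule cauchy_rel_lim_norm)

definition sgn_banach_completion :: "'a banach_completion \<Rightarrow> 'a banach_completion" where
  "sgn_banach_completion x = scaleR (inverse (norm x)) x"

definition dist_banach_completion :: "'a banach_completion \<Rightarrow> 'a banach_completion \<Rightarrow> real" where
  "dist_banach_completion x y = norm (x - y)"

definition uniformity_banach_completion ::
    "('a banach_completion \<times> 'a banach_completion) filter" where
  "uniformity_banach_completion = (INF e\<in>{0<..}. principal {(x, y). dist x y < e})"

definition open_banach_completion :: "'a banach_completion set \<Rightarrow> bool" where
  "open_banach_completion U \<longleftrightarrow> (\<forall>x\<in>U. \<forall>\<^sub>F (x', y) in uniformity. x' = x \<longrightarrow> y \<in> U)"

instance
proof
  fix x y z :: "'a banach_completion" and r s :: real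
  show "dist x y = norm (x - y)" by (rule dist_banach_completion_def)
  show "sgn x = scaleR (inverse (norm x)) x" by (rule sgn_banach_completion_def)
  show "(uniformity :: ('a banach_completion \<times> 'a banach_completion) filter) =
      (INF e\<in>{0<..}. principal {(x, y). dist x y < e})"
    by (rule uniformity_banach_completion_def)
  show "open U \<longleftrightarrow> (\<forall>x\<in>U. \<forall>\<^sub>F (x', y) in uniformity. x' = x \<longrightarrow> y \<in> U)"
    for U :: "'a banach_completion set"
    by (rule open_banach_completion_def)
  show "x + y + z = x + (y + z)"
    by transfer (simp add: cauchy_rel_def Cauchy_add_seq algebra_simps)
  show "x + y = y + x"
    by transfer (simp add: cauchy_rel_def Cauchy_add_seq algebra_simps)
  show "0 + x = x"
    by transfer (simp add: cauchy_rel_def)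
  show "- x + x = 0"
    by transfer (simp add: cauchy_rel_def convergent_Cauchy convergent_const)
  show "x - y = x + - y"
    by transfer (simp add: cauchy_rel_def Cauchy_diff_seq)
  show "r *\<^sub>R (x + y) = r *\<^sub>R x + r *\<^sub>R y"
    by transfer (simp add: cauchy_rel_def Cauchy_add_seq Cauchy_scaleR_seq algebra_simps)
  show "(r + s) *\<^sub>R x = r *\<^sub>R x + s *\<^sub>R x"
    by transfer (simp add: cauchy_rel_def Cauchy_add_seq Cauchy_scaleR_seq algebra_simps)
  show "r *\<^sub>R s *\<^sub>R x = (r * s) *\<^sub>R x"
    by transfer (simp add: cauchy_rel_def Cauchy_scaleR_seq)
  show "1 *\<^sub>R x = x"
    by transfer (simp add: cauchy_rel_def)
  show "norm x = 0 \<longleftrightarrow> x = 0"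
  proof (transfer, rule iffI)
    fix x :: "nat \<Rightarrow> 'a" assume x: "cauchy_rel x x"
    then have c: "Cauchy x" by (simp add: cauchy_rel_def)
    show "cauchy_rel x (\<lambda>_. 0)" if "lim (\<lambda>n. norm (x n)) = 0"
      using norm_seq_tendsto[OF c] that c tendsto_norm_zero_iff[of x sequentially]
      by (simp add: cauchy_rel_def convergent_Cauchy convergent_const)
    show "lim (\<lambda>n. norm (x n)) = 0" if "cauchy_rel x (\<lambda>_. 0)"
      using cauchy_rel_lim_norm[OF that] by simp
  qed
  show "norm (x + y) \<le> norm x + norm y"
  proof transfer
    fix x y :: "nat \<Rightarrow> 'a" assume "cauchy_rel x x" "cauchy_rel y y"
    then have c: "Cauchy x" "Cauchy y" by (simp_all add: cauchy_rel_def)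
    show "lim (\<lambda>n. norm (x n + y n)) \<le> lim (\<lambda>n. norm (x n)) + lim (\<lambda>n. norm (y n))"
      by (rule LIMSEQ_le[OF norm_seq_tendsto[OF Cauchy_add_seq[OF c]]
            tendsto_add[OF norm_seq_tendsto[OF c(1)] norm_seq_tendsto[OF c(2)]]])
        (auto intro: norm_triangle_ineq)
  qed
  show "norm (r *\<^sub>R x) = \<bar>r\<bar> * norm x"
  proof transfer
    fix r and x :: "nat \<Rightarrow> 'a" assume "cauchy_rel x x"
    then have c: "Cauchy x" by (simp add: cauchy_rel_def)
    show "lim (\<lambda>n. norm (r *\<^sub>R x n)) = \<bar>r\<bar> * lim (\<lambda>n. norm (x n))"
      using tendsto_mult_left[OF norm_seq_tendsto[OF c], of "\<bar>r\<bar>"] by (simp add: limI)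
  qed
qed

end

lift_definition to_completion :: "'a::real_normed_vector \<Rightarrow> 'a banach_completion" is "\<lambda>a _. a"
  by (simp add: cauchy_rel_def convergent_Cauchy convergent_const)

lemma norm_to_completion: "norm (to_completion a) = norm a"
  by transfer simp

lemma linear_to_completion: "linear to_completion"
proof (rule linearI)
  show "to_completion (a + b) = to_completion a + to_completion b" for a b :: 'a
    by transfer (simp add: cauchy_rel_def convergent_Cauchy convergent_const)
  show "to_completion (r *\<^sub>R a) = r *\<^sub>R to_completion a" for r and a :: 'a
    by transfer (simp add: cauchy_rel_def convergent_Cauchy convergent_const)
qed

lemma to_completion_diff: "to_completion (a - b) = to_completion a - to_completion b"
  by (rule linear_diff[OF linear_to_completion])

lemma to_completion_tendsto:
  assumes "Cauchy a"
  shows "(\<lambda>k. to_completion (a k)) \<longlonglongrightarrow> abs_banach_completion a"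
proof (rule metric_LIMSEQ_I)
  fix e :: real assume "0 < e"
  then have e: "0 < e/2" by simp
  obtain M where M: "\<forall>m\<ge>M. \<forall>n\<ge>M. dist (a m) (a n) < e/2"
    using metric_CauchyD[OF assms e] by blast
  have rel: "cauchy_rel a a" using assms by (simp add: cauchy_rel_def)
  have "dist (to_completion (a k)) (abs_banach_completion a) < e" if "k \<ge> M" for k
  proof -
    have c: "Cauchy (\<lambda>n. a k - a n)"
      by (intro Cauchy_diff_seq assms) (simp add: convergent_Cauchy convergent_const)
    have k: "cauchy_rel (\<lambda>_. a k) (\<lambda>_. a k)"
      by (simp add: cauchy_rel_def convergent_Cauchy convergent_const)
    have "to_completion (a k) - abs_banach_completion a = abs_banach_completion (\<lambda>n. a k - a n)"
      unfolding to_completion.abs_eq by (rule minus_banach_completion.abs_eq[OF k rel])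
    moreover have "norm (abs_banach_completion (\<lambda>n. a k - a n)) = lim (\<lambda>n. norm (a k - a n))"
      by (rule norm_banach_completion.abs_eq) (simp add: cauchy_rel_def c)
    moreover have "lim (\<lambda>n. norm (a k - a n)) \<le> e/2"
      by (rule LIMSEQ_le_const2[OF norm_seq_tendsto[OF c]])
        (use M that in \<open>force simp: dist_norm intro: less_imp_le\<close>)
    ultimately show ?thesis using \<open>0 < e\<close> by (simp add: dist_norm)
  qed
  then show "\<exists>M. \<forall>k\<ge>M. dist (to_completion (a k)) (abs_banach_completion a) < e" by blast
qed

lemma abs_banach_completion_cases:
  obtains a where "Cauchy a" "x = abs_banach_completion a"
proof -
  have "cauchy_rel (rep_banach_completion x) (rep_banach_completion x)"
    by (rule Quotient3_rep_reflp[OF Quotient3_banach_completion])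
  then have "Cauchy (rep_banach_completion x)" by (simp add: cauchy_rel_def)
  then show ?thesis
    by (rule that) (rule Quotient3_abs_rep[OF Quotient3_banach_completion, symmetric])
qed

lemma closure_range_to_completion: "closure (range to_completion) = UNIV"
proof -
  have "x \<in> closure (range to_completion)" for x :: "'a banach_completion"
  proof -
    obtain a where "Cauchy a" and x: "x = abs_banach_completion a"
      by (rule abs_banach_completion_cases)
    show ?thesis
      unfolding x closure_sequential
      by (intro exI[of _ "\<lambda>k. to_completion (a k)"] conjI allI rangeI
          to_completion_tendsto \<open>Cauchy a\<close>)
  qed
  then show ?thesis by auto
qed

instance banach_completion :: (real_normed_vector) banach
proof
  fix X :: "nat \<Rightarrow> 'a banach_completion" assume X: "Cauchy X"
  have "\<exists>a. dist (to_completion a) (X k) < inverse (real (Suc k))" for k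
  proof -
    have "X k \<in> closure (range to_completion)" by (simp add: closure_range_to_completion)
    then show ?thesis unfolding closure_approachable by fastforce
  qed
  then obtain a where a: "\<And>k. dist (to_completion (a k)) (X k) < inverse (real (Suc k))" by metis
  have "(\<lambda>k. dist (to_completion (a k)) (X k)) \<longlonglongrightarrow> 0"
    by (rule tendsto_sandwich[OF _ _ tendsto_const LIMSEQ_inverse_real_of_nat])
      (use less_imp_le[OF a] in \<open>auto simp del: of_nat_Suc\<close>)
  then have null: "(\<lambda>k. to_completion (a k) - X k) \<longlonglongrightarrow> 0"
    by (simp add: dist_norm tendsto_norm_zero_iff)
  have "Cauchy (\<lambda>k. (to_completion (a k) - X k) + X k)"
    by (intro Cauchy_add_seq X convergent_Cauchy) (use null convergentI in blast)
  then have "Cauchy (\<lambda>k. to_completion (a k))" by simp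
  then have "Cauchy a"
    unfolding Cauchy_def
    by (simp add: dist_norm flip: to_completion_diff) (simp add: norm_to_completion)
  from tendsto_diff[OF to_completion_tendsto[OF this] null] show "convergent X"
    by (auto intro: convergentI)
qed

section \<open>The binary tree space\<close>

text \<open>Nodes of the tree are finite 0-1 sequences, i.e. terms of type \<^typ>\<open>bool list\<close>, ordered by
  \<^const>\<open>prefix\<close>.\<close>

definition tree_chains :: "bool list set set" where
  "tree_chains = {A. A \<noteq> {} \<and> Complete_Partial_Order.chain prefix A}"

typedef c00_tree = "{x :: bool list \<Rightarrow> real. finite {t. x t \<noteq> 0}}"
  by (rule exI[of _ "\<lambda>_. 0"]) simp

setup_lifting type_definition_c00_tree

text \<open>Chains may be infinite, hence the unordered sum \<^const>\<open>infsum\<close>; only finitely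
  many terms are nonzero.\<close>

definition chain_sum :: "(bool list \<Rightarrow> real) \<Rightarrow> bool list set \<Rightarrow> real" where
  "chain_sum x A = (\<Sum>\<^sub>\<infinity>t\<in>A. \<bar>x t\<bar>)"

definition tree_norm :: "(bool list \<Rightarrow> real) \<Rightarrow> real" where
  "tree_norm x = (SUP A\<in>tree_chains. chain_sum x A)"

lemma chain_sum_finite:
  assumes "finite F" "{t. x t \<noteq> 0} \<subseteq> F"
  shows "chain_sum x A = (\<Sum>t\<in>A \<inter> F. \<bar>x t\<bar>)"
proof -
  have "chain_sum x A = (\<Sum>\<^sub>\<infinity>t\<in>A \<inter> F. \<bar>x t\<bar>)"
    unfolding chain_sum_def by (rule infsum_cong_neutral) (use assms in auto)
  then show ?thesis using assms(1) by simp
qed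

lemma singleton_tree_chain: "{t} \<in> tree_chains"
  by (simp add: tree_chains_def chain_def)

lemma tree_chains_nonempty: "tree_chains \<noteq> {}"
  using singleton_tree_chain by blast

lemma bdd_above_chain_sum:
  assumes "finite {t. x t \<noteq> 0}" shows "bdd_above (chain_sum x ` tree_chains)"
proof (rule bdd_aboveI2)
  fix A
  show "chain_sum x A \<le> (\<Sum>t | x t \<noteq> 0. \<bar>x t\<bar>)"
    unfolding chain_sum_finite[OF assms order_refl] by (rule sum_mono2) (use assms in auto)
qed

lemma chain_sum_le_tree_norm:
  "finite {t. x t \<noteq> 0} \<Longrightarrow> A \<in> tree_chains \<Longrightarrow> chain_sum x A \<le> tree_norm x"
  unfolding tree_norm_def by (rule cSUP_upper) (auto intro: bdd_above_chain_sum)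

lemma finite_support_add:
  "finite {t. x t \<noteq> 0} \<Longrightarrow> finite {t. y t \<noteq> 0} \<Longrightarrow> finite {t. x t + y t \<noteq> (0::real)}"
  by (rule finite_subset[of _ "{t. x t \<noteq> 0} \<union> {t. y t \<noteq> 0}"]) auto

lemma finite_support_diff:
  "finite {t. x t \<noteq> 0} \<Longrightarrow> finite {t. y t \<noteq> 0} \<Longrightarrow> finite {t. x t - y t \<noteq> (0::real)}"
  by (rule finite_subset[of _ "{t. x t \<noteq> 0} \<union> {t. y t \<noteq> 0}"]) auto

instantiation c00_tree :: real_normed_vector
begin

lift_definition zero_c00_tree :: c00_tree is "\<lambda>_. 0" by simp

lift_definition plus_c00_tree :: "c00_tree \<Rightarrow> c00_tree \<Rightarrow> c00_tree" is "\<lambda>x y t. x t + y t"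
  by (rule finite_support_add)

lift_definition minus_c00_tree :: "c00_tree \<Rightarrow> c00_tree \<Rightarrow> c00_tree" is "\<lambda>x y t. x t - y t"
  by (rule finite_support_diff)

lift_definition uminus_c00_tree :: "c00_tree \<Rightarrow> c00_tree" is "\<lambda>x t. - x t" by simp

lift_definition scaleR_c00_tree :: "real \<Rightarrow> c00_tree \<Rightarrow> c00_tree" is "\<lambda>r x t. r * x t" by simp

lift_definition norm_c00_tree :: "c00_tree \<Rightarrow> real" is tree_norm .

definition sgn_c00_tree :: "c00_tree \<Rightarrow> c00_tree" where
  "sgn_c00_tree x = scaleR (inverse (norm x)) x"

definition dist_c00_tree :: "c00_tree \<Rightarrow> c00_tree \<Rightarrow> real" where
  "dist_c00_tree x y = norm (x - y)"

definition uniformity_c00_tree :: "(c00_tree \<times> c00_tree) filter" where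
  "uniformity_c00_tree = (INF e\<in>{0<..}. principal {(x, y). dist x y < e})"

definition open_c00_tree :: "c00_tree set \<Rightarrow> bool" where
  "open_c00_tree U \<longleftrightarrow> (\<forall>x\<in>U. \<forall>\<^sub>F (x', y) in uniformity. x' = x \<longrightarrow> y \<in> U)"

instance
proof
  fix x y z :: c00_tree and r s :: real
  show "dist x y = norm (x - y)" by (rule dist_c00_tree_def)
  show "sgn x = scaleR (inverse (norm x)) x" by (rule sgn_c00_tree_def)
  show "(uniformity :: (c00_tree \<times> c00_tree) filter) =
      (INF e\<in>{0<..}. principal {(x, y). dist x y < e})"
    by (rule uniformity_c00_tree_def)
  show "open U \<longleftrightarrow> (\<forall>x\<in>U. \<forall>\<^sub>F (x', y) in uniformity. x' = x \<longrightarrow> y \<in> U)" for U :: "c00_tree set"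
    by (rule open_c00_tree_def)
  show "x + y + z = x + (y + z)" "x + y = y + x" "0 + x = x" "- x + x = 0" "x - y = x + - y"
    by (transfer; simp add: fun_eq_iff)+
  show "r *\<^sub>R (x + y) = r *\<^sub>R x + r *\<^sub>R y" "(r + s) *\<^sub>R x = r *\<^sub>R x + s *\<^sub>R x"
    "r *\<^sub>R s *\<^sub>R x = (r * s) *\<^sub>R x" "1 *\<^sub>R x = x"
    by (transfer; simp add: fun_eq_iff algebra_simps)+
  show "norm x = 0 \<longleftrightarrow> x = 0"
  proof (transfer, rule iffI)
    fix x :: "bool list \<Rightarrow> real" assume f: "finite {t. x t \<noteq> 0}"
    show "x = (\<lambda>_. 0)" if "tree_norm x = 0"
    proof
      fix t
      show "x t = 0"
        using chain_sum_le_tree_norm[OF f singleton_tree_chain[of t]] that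
        by (simp add: chain_sum_def)
    qed
    show "tree_norm x = 0" if "x = (\<lambda>_. 0)"
      using that tree_chains_nonempty by (simp add: tree_norm_def chain_sum_def)
  qed
  show "norm (x + y) \<le> norm x + norm y"
  proof transfer
    fix x y :: "bool list \<Rightarrow> real" assume f: "finite {t. x t \<noteq> 0}" "finite {t. y t \<noteq> 0}"
    let ?F = "{t. x t \<noteq> 0} \<union> {t. y t \<noteq> 0}"
    have F: "finite ?F" using f by simp
    show "tree_norm (\<lambda>t. x t + y t) \<le> tree_norm x + tree_norm y"
      unfolding tree_norm_def[of "\<lambda>t. x t + y t"]
    proof (rule cSUP_least[OF tree_chains_nonempty])
      fix A assume A: "A \<in> tree_chains"
      have "chain_sum (\<lambda>t. x t + y t) A = (\<Sum>t\<in>A \<inter> ?F. \<bar>x t + y t\<bar>)"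
        by (rule chain_sum_finite[OF F]) auto
      also have "\<dots> \<le> (\<Sum>t\<in>A \<inter> ?F. \<bar>x t\<bar> + \<bar>y t\<bar>)"
        by (intro sum_mono abs_triangle_ineq)
      also have "\<dots> = chain_sum x A + chain_sum y A"
        unfolding chain_sum_finite[OF F Un_upper1] chain_sum_finite[OF F Un_upper2]
        by (rule sum.distrib)
      also have "\<dots> \<le> tree_norm x + tree_norm y"
        by (intro add_mono chain_sum_le_tree_norm f A)
      finally show "chain_sum (\<lambda>t. x t + y t) A \<le> tree_norm x + tree_norm y" .
    qed
  qed
  show "norm (r *\<^sub>R x) = \<bar>r\<bar> * norm x"
  proof transfer
    fix r and x :: "bool list \<Rightarrow> real" assume f: "finite {t. x t \<noteq> 0}"
    have "chain_sum (\<lambda>t. r * x t) A = \<bar>r\<bar> * chain_sum x A" for A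
      by (simp add: chain_sum_def abs_mult infsum_cmult_right')
    moreover have "(SUP A\<in>tree_chains. \<bar>r\<bar> * chain_sum x A) = \<bar>r\<bar> * tree_norm x"
      unfolding tree_norm_def
      using continuous_at_Sup_mono[of "\<lambda>u. \<bar>r\<bar> * u" "chain_sum x ` tree_chains"]
        bdd_above_chain_sum[OF f] tree_chains_nonempty
      by (simp add: image_image mono_def mult_left_mono continuous_intros)
    ultimately show "tree_norm (\<lambda>t. r * x t) = \<bar>r\<bar> * tree_norm x"
      by (simp add: tree_norm_def)
  qed
qed

end

type_synonym binary_tree_space = "c00_tree banach_completion"

section \<open>Slices, denting points and slicely countably determined sets\<close>

text \<open>The notions below are meant for bounded non-empty sets \<open>A\<close>.\<close>

definition strongly_exposed :: "'a::real_normed_vector set \<Rightarrow> 'a \<Rightarrow> bool" where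
  "strongly_exposed A x \<longleftrightarrow> x \<in> A \<and>
    (\<exists>f :: 'a \<Rightarrow>\<^sub>L real. \<forall>xs. range xs \<subseteq> A \<longrightarrow>
      ((\<lambda>n. blinfun_apply f (xs n)) \<longlonglongrightarrow> blinfun_apply f x \<longleftrightarrow> xs \<longlonglongrightarrow> x))"

definition slice :: "'a::real_normed_vector set \<Rightarrow> ('a \<Rightarrow>\<^sub>L real) \<Rightarrow> real \<Rightarrow> 'a set" where
  "slice A f \<delta> = {x \<in> A. blinfun_apply f x > Sup (blinfun_apply f ` A) - \<delta>}"

definition slices :: "'a::real_normed_vector set \<Rightarrow> 'a set set" where
  "slices A = {slice A f \<delta> | f \<delta>. \<delta> > 0}"

definition denting :: "'a::real_normed_vector set \<Rightarrow> 'a \<Rightarrow> bool" where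
  "denting A x \<longleftrightarrow> x \<in> A \<and> (\<forall>\<epsilon>>0. \<exists>S\<in>slices A. x \<in> S \<and> diameter S < \<epsilon>)"

definition generating :: "'a::real_normed_vector set \<Rightarrow> 'a set \<Rightarrow> bool" where
  "generating A G \<longleftrightarrow> G \<subseteq> A \<and> A \<subseteq> closure (convex hull G)"

definition dentable :: "'a::real_normed_vector set \<Rightarrow> bool" where
  "dentable A \<longleftrightarrow> generating A {x. denting A x}"

definition determining :: "'a::real_normed_vector set \<Rightarrow> 'i set \<Rightarrow> ('i \<Rightarrow> 'a set) \<Rightarrow> bool" where
  "determining A I S \<longleftrightarrow> (\<forall>i\<in>I. S i \<noteq> {} \<and> S i \<subseteq> A) \<and>
    (\<forall>x. (\<forall>i\<in>I. x i \<in> S i) \<longrightarrow> A \<subseteq> closure (convex hull (x ` I)))"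

text \<open>Index sets \<open>I \<subseteq> \<nat>\<close> account for all countable collections, finite ones included.\<close>

definition SCD :: "'a::real_normed_vector set \<Rightarrow> bool" where
  "SCD A \<longleftrightarrow> (\<exists>(I :: nat set) S. (\<forall>i\<in>I. S i \<in> slices A) \<and> determining A I S)"

end

theory Submission
  imports Defs
begin

text \<open>
  Every chain continues into a single subtree below the root, so the space is its own
  \<open>\<real> \<oplus>\<^sub>1 (X \<oplus>\<^sub>\<infinity> X)\<close>: this is \<open>norm_eq_root_plus_max_child\<close>. The unit ball of an
  \<open>\<ell>\<^sub>1\<close>-sum is spanned by the balls of the two summands, and the ball of an \<open>\<ell>\<^sub>\<infinity>\<close>-sum is the
  product of the balls. Unfolding this finitely often exhibits each finitely supported vector
  of the ball as a convex combination of vectors with entries \<open>\<plusminus>1\<close> on a finite maximal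
  antichain and \<open>0\<close> elsewhere (\<open>c00_ball_subset_convex_hull\<close>). The ball of the completion is
  the closure of the finitely supported ball, so these signed antichains generate it.

  Each signed antichain \<open>v\<close> is strongly exposed by a positively weighted sum \<open>f\<close> of its signed
  coordinates. If \<open>f x\<close> is almost \<open>1\<close>, then all entries of \<open>x\<close> on the antichain are almost
  those of \<open>v\<close>; every branch meets the antichain, so the remaining entries on that branch have
  almost no mass left, uniformly over the branches. Quantitatively
  \<open>norm (x - v) \<le> K * (1 - f x)\<close> on the unit ball
  (\<open>antichain_vec_sharply_exposed\<close>). Such a linear estimate is a closed condition on \<open>x\<close>,
  hence survives the completion, and it makes \<open>v\<close> both strongly exposed and denting.

  Finally there are only countably many signed antichains, and small slices around countably
  many generating denting points form a determining family.
\<close>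

section \<open>Sharp exposure and slices\<close>

text \<open>The estimate below controls the distance to \<open>x\<close> linearly by the deficit of \<open>f\<close>. It is the
  common source of strong exposure and of small slices, and unlike either of them it passes to
  closures because it is a closed condition on \<open>y\<close>.\<close>

lemma sharp_exposure_imp_strongly_exposed:
  fixes f :: "'a::real_normed_vector \<Rightarrow>\<^sub>L real"
  assumes "x \<in> A"
    and sharp: "\<And>y. y \<in> A \<Longrightarrow> norm (y - x) \<le> K * (f x - f y)"
  shows "strongly_exposed A x"
  unfolding strongly_exposed_def
proof (intro conjI exI allI impI iffI)
  fix xs :: "nat \<Rightarrow> 'a"
  assume xs: "range xs \<subseteq> A" and "(\<lambda>n. f (xs n)) \<longlonglongrightarrow> f x"
  then have "(\<lambda>n. K * (f x - f (xs n))) \<longlonglongrightarrow> K * (f x - f x)"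
    by (intro tendsto_mult_left tendsto_diff tendsto_const)
  then have "(\<lambda>n. K * (f x - f (xs n))) \<longlonglongrightarrow> 0" by simp
  then have "(\<lambda>n. xs n - x) \<longlonglongrightarrow> 0"
    by (rule Lim_null_comparison[rotated]) (use xs sharp in \<open>auto intro!: always_eventually\<close>)
  then show "xs \<longlonglongrightarrow> x" by (rule LIM_zero_cancel)
next
  fix xs :: "nat \<Rightarrow> 'a"
  assume "xs \<longlonglongrightarrow> x"
  then show "(\<lambda>n. f (xs n)) \<longlonglongrightarrow> f x" by (intro tendsto_intros)
qed (fact \<open>x \<in> A\<close>)

text \<open>The estimate forces \<open>f\<close> to attain its supremum over \<open>A\<close> at \<open>x\<close>, so the slice of width
  \<open>\<delta>\<close> lies in the ball of radius \<open>K * \<delta>\<close> around \<open>x\<close>.\<close>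

lemma sharp_exposure_imp_denting:
  fixes f :: "'a::real_normed_vector \<Rightarrow>\<^sub>L real"
  assumes "x \<in> A" "K > 0"
    and sharp: "\<And>y. y \<in> A \<Longrightarrow> norm (y - x) \<le> K * (f x - f y)"
  shows "denting A x"
  unfolding denting_def
proof (intro conjI allI impI)
  fix \<epsilon> :: real assume "\<epsilon> > 0"
  \<comment> \<open>Radius \<open>\<epsilon>/4\<close> around \<open>x\<close> gives diameter at most \<open>\<epsilon>/2\<close>, strictly below \<open>\<epsilon>\<close>.\<close>
  define \<delta> where "\<delta> = \<epsilon> / (4 * K)"
  have "\<delta> > 0" using \<open>\<epsilon> > 0\<close> \<open>K > 0\<close> by (simp add: \<delta>_def)
  have "f y \<le> f x" if "y \<in> A" for y
  proof -
    have "0 \<le> K * (f x - f y)" using sharp[OF that] norm_ge_zero order_trans by blast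
    then show ?thesis using \<open>K > 0\<close> by (simp add: zero_le_mult_iff)
  qed
  then have Sup: "Sup (f ` A) = f x"
    by (intro cSup_eq_maximum) (use \<open>x \<in> A\<close> in auto)
  have near: "dist y x \<le> \<epsilon> / 4" if "y \<in> slice A f \<delta>" for y
  proof -
    have "y \<in> A" "f x - f y \<le> \<delta>" using that by (auto simp: slice_def Sup)
    then have "norm (y - x) \<le> K * \<delta>"
      using sharp \<open>K > 0\<close> by (meson mult_left_mono less_imp_le order_trans)
    then show ?thesis using \<open>K > 0\<close> by (simp add: \<delta>_def dist_norm)
  qed
  have "diameter (slice A f \<delta>) \<le> \<epsilon> / 2"
  proof (rule diameter_le)
    show "norm (y - z) \<le> \<epsilon> / 2" if "y \<in> slice A f \<delta>" "z \<in> slice A f \<delta>" for y z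
      using near[OF that(1)] near[OF that(2)] dist_triangle2[of y z x]
      by (simp add: dist_norm)
  qed (use \<open>\<epsilon> > 0\<close> in auto)
  moreover have "x \<in> slice A f \<delta>"
    using \<open>x \<in> A\<close> \<open>\<delta> > 0\<close> by (simp add: slice_def Sup)
  moreover have "slice A f \<delta> \<in> slices A" using \<open>\<delta> > 0\<close> by (auto simp: slices_def)
  ultimately show "\<exists>S\<in>slices A. x \<in> S \<and> diameter S < \<epsilon>"
    using \<open>\<epsilon> > 0\<close> by (intro bexI[of _ "slice A f \<delta>"]) auto
qed (fact \<open>x \<in> A\<close>)

text \<open>For each point of \<open>D\<close> take slices around it of diameter tending to zero. Any choice of one
  point per slice then accumulates at every point of \<open>D\<close>, so its closed convex hull contains
  \<open>D\<close> and with it \<open>A\<close>.\<close>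

lemma countable_denting_generating_imp_SCD:
  fixes A :: "'a::real_normed_vector set"
  assumes "bounded A" "countable D"
    and dent: "\<And>x. x \<in> D \<Longrightarrow> denting A x"
    and gen: "A \<subseteq> closure (convex hull D)"
  shows "SCD A"
proof (cases "D = {}")
  \<comment> \<open>Then \<open>A\<close> is empty too, and the empty family of slices determines it.\<close>
  case True
  then show ?thesis
    using gen unfolding SCD_def determining_def by (intro exI[of _ "{}"]) auto
next
  case False
  define d where "d = from_nat_into D"
  have d: "d i \<in> D" for i unfolding d_def using False by (rule from_nat_into)
  have range_d: "range d = D"
    unfolding d_def by (rule range_from_nat_into[OF False assms(2)])
  have "\<exists>S. S \<in> slices A \<and> d i \<in> S \<and> diameter S < inverse (real (Suc n))" for i n
    using dent[OF d[of i]] unfolding denting_def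
    by (meson inverse_positive_iff_positive of_nat_0_less_iff zero_less_Suc)
  then obtain S where S: "\<And>i n. S i n \<in> slices A" "\<And>i n. d i \<in> S i n"
      "\<And>i n. diameter (S i n) < inverse (real (Suc n))"
    by metis
  have sub: "S i n \<subseteq> A" for i n using S(1)[of i n] by (auto simp: slices_def slice_def)
  \<comment> \<open>The index set has to consist of natural numbers, so the double family is coded by pairs.\<close>
  define T where "T = (\<lambda>k. case prod_decode k of (i, n) \<Rightarrow> S i n)"
  have "A \<subseteq> closure (convex hull (range x))" if x: "\<forall>k. x k \<in> T k" for x
  proof -
    have "d i \<in> closure (convex hull (range x))" for i
    proof -
      let ?y = "\<lambda>n. x (prod_encode (i, n))"
      have "norm (?y n - d i) \<le> inverse (real (Suc n))" for n
      proof -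
        have "?y n \<in> S i n" using x[rule_format, of "prod_encode (i, n)"] by (simp add: T_def)
        then have "dist (?y n) (d i) \<le> diameter (S i n)"
          using S(2) bounded_subset[OF \<open>bounded A\<close> sub] by (intro diameter_bounded_bound)
        then show ?thesis using S(3)[of i n] by (simp add: dist_norm)
      qed
      then have "(\<lambda>n. ?y n - d i) \<longlonglongrightarrow> 0"
        by (intro Lim_null_comparison[OF _ LIMSEQ_inverse_real_of_nat] always_eventually allI)
      then have "?y \<longlonglongrightarrow> d i" using Lim_null by blast
      then show ?thesis
        unfolding closure_sequential by (meson hull_inc rangeI)
    qed
    then have "D \<subseteq> closure (convex hull (range x))" using range_d by auto
    then have "convex hull D \<subseteq> closure (convex hull (range x))"
      by (intro hull_minimal) (auto intro: convex_closure)
    then show ?thesis using gen closure_minimal[OF _ closed_closure] by blast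
  qed
  moreover have "T k \<noteq> {} \<and> T k \<subseteq> A \<and> T k \<in> slices A" for k
    using S sub unfolding T_def by (cases "prod_decode k") fastforce
  ultimately show ?thesis
    unfolding SCD_def determining_def by (intro exI[of _ UNIV] exI[of _ T]) auto
qed

section \<open>Passing to the completion\<close>

lemma tendsto_blinfun_lim:
  fixes g :: "'a::real_normed_vector \<Rightarrow>\<^sub>L real"
  assumes "Cauchy x"
  shows "(\<lambda>n. g (x n)) \<longlonglongrightarrow> lim (\<lambda>n. g (x n))"
  using bounded_linear.Cauchy[OF blinfun.bounded_linear_right assms]
    Cauchy_convergent convergent_LIMSEQ_iff by blast

lift_definition extend_functional ::
    "('a::real_normed_vector \<Rightarrow>\<^sub>L real) \<Rightarrow> 'a banach_completion \<Rightarrow> real"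
  is "\<lambda>g x. lim (\<lambda>n. blinfun_apply g (x n))"
proof -
  fix g :: "'a \<Rightarrow>\<^sub>L real" and x y :: "nat \<Rightarrow> 'a"
  assume xy: "cauchy_rel x y"
  then have "(\<lambda>n. g (x n - y n)) \<longlonglongrightarrow> g 0"
    unfolding cauchy_rel_def by (intro tendsto_intros) auto
  then have "(\<lambda>n. g (x n) - g (y n)) \<longlonglongrightarrow> 0" by (simp add: blinfun.diff_right)
  moreover have "(\<lambda>n. g (x n) - g (y n)) \<longlonglongrightarrow> lim (\<lambda>n. g (x n)) - lim (\<lambda>n. g (y n))"
    using xy by (intro tendsto_diff tendsto_blinfun_lim) (auto simp: cauchy_rel_def)
  ultimately show "lim (\<lambda>n. g (x n)) = lim (\<lambda>n. g (y n))"
    using LIMSEQ_unique by fastforce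
qed

lemma functional_extends_to_completion:
  fixes g :: "'a::real_normed_vector \<Rightarrow>\<^sub>L real"
  shows "\<exists>f :: 'a banach_completion \<Rightarrow>\<^sub>L real. \<forall>a. f (to_completion a) = g a"
proof -
  have "bounded_linear (extend_functional g)"
  proof (rule bounded_linear_intro)
    show "extend_functional g (x + y) = extend_functional g x + extend_functional g y" for x y
    proof (transfer fixing: g)
      fix x y :: "nat \<Rightarrow> 'a" assume "cauchy_rel x x" "cauchy_rel y y"
      then have "(\<lambda>n. g (x n) + g (y n)) \<longlonglongrightarrow> lim (\<lambda>n. g (x n)) + lim (\<lambda>n. g (y n))"
        by (intro tendsto_add tendsto_blinfun_lim) (auto simp: cauchy_rel_def)
      then show "lim (\<lambda>n. g (x n + y n)) = lim (\<lambda>n. g (x n)) + lim (\<lambda>n. g (y n))"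
        by (simp add: blinfun.add_right limI)
    qed
    show "extend_functional g (r *\<^sub>R x) = r *\<^sub>R extend_functional g x" for r x
    proof (transfer fixing: g)
      fix r and x :: "nat \<Rightarrow> 'a" assume "cauchy_rel x x"
      then have "(\<lambda>n. r * g (x n)) \<longlonglongrightarrow> r * lim (\<lambda>n. g (x n))"
        by (intro tendsto_mult_left tendsto_blinfun_lim) (auto simp: cauchy_rel_def)
      then show "lim (\<lambda>n. g (r *\<^sub>R x n)) = r *\<^sub>R lim (\<lambda>n. g (x n))"
        by (simp add: blinfun.scaleR_right limI)
    qed
    show "norm (extend_functional g x) \<le> norm x * norm g" for x
    proof (transfer fixing: g)
      fix x :: "nat \<Rightarrow> 'a" assume "cauchy_rel x x"
      then have c: "Cauchy x" by (simp add: cauchy_rel_def)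
      show "norm (lim (\<lambda>n. g (x n))) \<le> lim (\<lambda>n. norm (x n)) * norm g"
        by (rule LIMSEQ_le[OF tendsto_norm[OF tendsto_blinfun_lim[OF c]]
              tendsto_mult_right[OF norm_seq_tendsto[OF c]]])
          (simp add: norm_blinfun[of g, unfolded mult.commute[of "norm g"]] del: real_norm_def)
    qed
  qed
  then have "blinfun_apply (Blinfun (extend_functional g)) = extend_functional g"
    by (rule bounded_linear_Blinfun_apply)
  moreover have "extend_functional g (to_completion a) = g a" for a
    by transfer simp
  ultimately show ?thesis by metis
qed

text \<open>A sequence approximating a point of the ball may leave the ball slightly; dividing by
  \<open>max 1 (norm a)\<close> pushes it back continuously, which does not move the limit.\<close>

lemma completion_cball_subset_closure:
  "cball (0 :: 'a::real_normed_vector banach_completion) 1 \<subseteq> closure (to_completion ` cball 0 1)"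
proof
  fix y :: "'a banach_completion" assume y: "y \<in> cball 0 1"
  have "y \<in> closure (range to_completion)" by (simp add: closure_range_to_completion)
  then obtain z where z: "\<And>n. z n \<in> range to_completion" "z \<longlonglongrightarrow> y"
    unfolding closure_sequential by blast
  from z(1) obtain a where "\<And>n. z n = to_completion (a n)" unfolding image_iff by metis
  then have "z = (\<lambda>n. to_completion (a n))" ..
  with z(2) have a: "(\<lambda>n. to_completion (a n)) \<longlonglongrightarrow> y" by simp
  let ?b = "\<lambda>n. inverse (max 1 (norm (a n))) *\<^sub>R a n"
  have "(\<lambda>n. inverse (max 1 (norm (to_completion (a n)))) *\<^sub>R to_completion (a n))
      \<longlonglongrightarrow> inverse (max 1 (norm y)) *\<^sub>R y"
    by (intro tendsto_intros a) auto
  moreover have "max 1 (norm y) = 1" using y by simp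
  ultimately have "(\<lambda>n. to_completion (?b n)) \<longlonglongrightarrow> y"
    by (simp add: linear_scale[OF linear_to_completion] norm_to_completion)
  moreover have "?b n \<in> cball 0 1" for n
    by (simp add: field_simps max_def)
  ultimately show "y \<in> closure (to_completion ` cball 0 1)"
    unfolding closure_sequential by (intro exI[of _ "\<lambda>n. to_completion (?b n)"]) auto
qed

section \<open>Self-similarity of the tree norm\<close>

lift_definition entry :: "c00_tree \<Rightarrow> bool list \<Rightarrow> real" is "\<lambda>x. x" .

lemma finite_support_entry: "finite {t. entry x t \<noteq> 0}"
  by transfer

lemma c00_tree_eqI: "(\<And>t. entry x t = entry y t) \<Longrightarrow> x = y"
  by transfer auto

lemma entry_simps [simp]:
  "entry (x + y) t = entry x t + entry y t" "entry (x - y) t = entry x t - entry y t"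
  "entry (r *\<^sub>R x) t = r * entry x t" "entry 0 t = 0"
  by (transfer; simp)+

lift_definition child :: "bool \<Rightarrow> c00_tree \<Rightarrow> c00_tree" is "\<lambda>b x t. x (b # t)"
proof -
  fix b and x :: "bool list \<Rightarrow> real" assume "finite {t. x t \<noteq> 0}"
  then have "finite (Cons b -` {t. x t \<noteq> 0})" by (intro finite_vimageI) auto
  then show "finite {t. x (b # t) \<noteq> 0}" by (simp add: vimage_def)
qed

lift_definition node :: "real \<Rightarrow> c00_tree \<Rightarrow> c00_tree \<Rightarrow> c00_tree"
  is "\<lambda>r x y t. case t of [] \<Rightarrow> r | b # s \<Rightarrow> (if b then x s else y s)"
proof -
  fix r and x y :: "bool list \<Rightarrow> real" assume "finite {t. x t \<noteq> 0}" "finite {t. y t \<noteq> 0}"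
  then have "finite (insert [] (Cons True ` {t. x t \<noteq> 0} \<union> Cons False ` {t. y t \<noteq> 0}))" by auto
  then show "finite {t. (case t of [] \<Rightarrow> r | b # s \<Rightarrow> (if b then x s else y s)) \<noteq> 0}"
    by (rule rev_finite_subset) (auto split: list.split_asm if_split_asm)
qed

lemma entry_child [simp]: "entry (child b x) t = entry x (b # t)"
  by transfer simp

lemma entry_node [simp]:
  "entry (node r x y) [] = r"
  "entry (node r x y) (b # t) = (if b then entry x t else entry y t)"
  by (transfer; simp)+

lemma child_simps [simp]:
  "child b (x + y) = child b x + child b y" "child b (x - y) = child b x - child b y"
  "child b (r *\<^sub>R x) = r *\<^sub>R child b x" "child b 0 = 0"
  "child b (node r x y) = (if b then x else y)"
  by (rule c00_tree_eqI; simp)+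

lemma node_collapse: "node (entry x []) (child True x) (child False x) = x"
proof (rule c00_tree_eqI)
  show "entry (node (entry x []) (child True x) (child False x)) t = entry x t" for t
    by (cases t) auto
qed

lemma norm_c00_tree_eq: "norm x = (SUP A\<in>tree_chains. chain_sum (entry x) A)"
  by transfer (simp add: tree_norm_def)

lemma chain_sum_le_norm: "A \<in> tree_chains \<Longrightarrow> chain_sum (entry x) A \<le> norm x"
  by transfer (rule chain_sum_le_tree_norm)

lemma chain_sum_insert_root:
  "chain_sum (entry x) (insert [] (Cons b ` B)) = \<bar>entry x []\<bar> + chain_sum (entry (child b x)) B"
proof -
  let ?F = "{t. entry (child b x) t \<noteq> 0}"
  let ?G = "{t. entry x t \<noteq> 0} \<union> insert [] (Cons b ` ?F)"
  have fin: "finite ?F" "finite ?G"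
    using finite_support_entry[of x] finite_support_entry[of "child b x"]
    by (simp_all del: entry_child)
  have "insert [] (Cons b ` B) \<inter> ?G = insert [] (Cons b ` (B \<inter> ?F))" by auto
  then have "chain_sum (entry x) (insert [] (Cons b ` B))
      = (\<Sum>t\<in>insert [] (Cons b ` (B \<inter> ?F)). \<bar>entry x t\<bar>)"
    using chain_sum_finite[OF fin(2), of "entry x" "insert [] (Cons b ` B)"] by (simp only: Un_upper1)
  also have "\<dots> = \<bar>entry x []\<bar> + (\<Sum>t\<in>Cons b ` (B \<inter> ?F). \<bar>entry x t\<bar>)"
    using fin(1) by (subst sum.insert) auto
  also have "(\<Sum>t\<in>Cons b ` (B \<inter> ?F). \<bar>entry x t\<bar>) = (\<Sum>t\<in>B \<inter> ?F. \<bar>entry (child b x) t\<bar>)"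
    by (subst sum.reindex) (auto simp: inj_on_def)
  also have "\<dots> = chain_sum (entry (child b x)) B"
    using chain_sum_finite[OF fin(1)] by simp
  finally show ?thesis .
qed

lemma chain_sum_mono: "A \<subseteq> B \<Longrightarrow> chain_sum (entry x) A \<le> chain_sum (entry x) B"
  unfolding chain_sum_finite[OF finite_support_entry order_refl]
  by (rule sum_mono2) (auto intro: finite_support_entry)

text \<open>The nodes of a chain other than the root are comparable, hence share their first letter.\<close>

lemma tree_chain_subset_branch:
  assumes "A \<in> tree_chains"
  obtains b B where "B \<in> tree_chains" "A \<subseteq> insert [] (Cons b ` B)"
proof (cases "A \<subseteq> {[]}")
  case True
  then show ?thesis using that[of "{[]}"] singleton_tree_chain by blast
next
  case False
  then obtain b s where bs: "b # s \<in> A" by (metis insertI1 neq_Nil_conv subsetI singletonI)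
  have ch: "Complete_Partial_Order.chain prefix A" using assms by (simp add: tree_chains_def)
  show ?thesis
  proof
    show "{t. b # t \<in> A} \<in> tree_chains"
      unfolding tree_chains_def using bs chainD[OF ch]
      by (auto intro!: chainI) (metis Cons_prefix_Cons)
    show "A \<subseteq> insert [] (Cons b ` {t. b # t \<in> A})"
    proof
      fix t assume "t \<in> A"
      then show "t \<in> insert [] (Cons b ` {t. b # t \<in> A})"
        using chainD[OF ch bs \<open>t \<in> A\<close>] by (cases t) (auto simp: Cons_prefix_Cons)
    qed
  qed
qed

text \<open>This recursion replaces chains in everything that follows: facts about the norm become
  structural inductions on finite trees.\<close>

lemma norm_eq_root_plus_max_child:
  "norm x = \<bar>entry x []\<bar> + max (norm (child True x)) (norm (child False x))"
proof (rule antisym)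
  let ?m = "max (norm (child True x)) (norm (child False x))"
  have child_le: "norm (child b x) \<le> ?m" for b by (cases b) auto
  show "norm x \<le> \<bar>entry x []\<bar> + ?m"
    unfolding norm_c00_tree_eq[of x]
  proof (rule cSUP_least[OF tree_chains_nonempty])
    fix A assume "A \<in> tree_chains"
    then obtain b B where B: "B \<in> tree_chains" "A \<subseteq> insert [] (Cons b ` B)"
      by (rule tree_chain_subset_branch)
    have "chain_sum (entry x) A \<le> \<bar>entry x []\<bar> + chain_sum (entry (child b x)) B"
      using chain_sum_mono[OF B(2)] by (simp add: chain_sum_insert_root)
    also have "\<dots> \<le> \<bar>entry x []\<bar> + ?m"
      using chain_sum_le_norm[OF B(1)] child_le order_trans by (intro add_left_mono) blast
    finally show "chain_sum (entry x) A \<le> \<bar>entry x []\<bar> + ?m" .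
  qed
  have "norm (child b x) \<le> norm x - \<bar>entry x []\<bar>" for b
    unfolding norm_c00_tree_eq[of "child b x"]
  proof (rule cSUP_least[OF tree_chains_nonempty])
    fix B assume "B \<in> tree_chains"
    then have "insert [] (Cons b ` B) \<in> tree_chains"
      by (fastforce simp: tree_chains_def chain_def)
    then show "chain_sum (entry (child b x)) B \<le> norm x - \<bar>entry x []\<bar>"
      using chain_sum_le_norm[of _ x] chain_sum_insert_root[of x b B]
      by (metis add.commute le_diff_eq)
  qed
  then show "\<bar>entry x []\<bar> + ?m \<le> norm x" by (simp add: max_def algebra_simps)
qed

lemma norm_child_le: "norm (child b x) \<le> norm x - \<bar>entry x []\<bar>"
  using norm_eq_root_plus_max_child[of x] by (cases b) auto

section \<open>Signed maximal antichains\<close>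

text \<open>A finite maximal antichain of the tree is either the root alone or splits into one such
  antichain in each of the two subtrees. Coding antichains by this datatype, with a sign at each of their
  nodes, makes them visibly countable and matches the recursion of the norm.\<close>

datatype signed_antichain = Root bool | Split signed_antichain signed_antichain

instance signed_antichain :: countable
  by countable_datatype

definition sign :: "bool \<Rightarrow> real" where
  "sign p = (if p then 1 else -1)"

fun antichain_vec :: "signed_antichain \<Rightarrow> c00_tree" where
  "antichain_vec (Root p) = node (sign p) 0 0"
| "antichain_vec (Split c d) = node 0 (antichain_vec c) (antichain_vec d)"

text \<open>The exposing functional. A node of the antichain at depth \<open>n\<close> gets weight \<open>1 / 2 ^ n\<close>, so
  the weights add up to \<open>1\<close> along the recursion.\<close>

fun antichain_avg :: "signed_antichain \<Rightarrow> c00_tree \<Rightarrow> real" where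
  "antichain_avg (Root p) x = sign p * entry x []"
| "antichain_avg (Split c d) x =
     (antichain_avg c (child True x) + antichain_avg d (child False x)) / 2"

lemma norm_antichain_vec: "norm (antichain_vec c) = 1"
  by (induction c) (subst norm_eq_root_plus_max_child; simp add: sign_def)+

lemma antichain_avg_antichain_vec: "antichain_avg c (antichain_vec c) = 1"
  by (induction c) (auto simp: sign_def)

lemma antichain_avg_add: "antichain_avg c (x + y) = antichain_avg c x + antichain_avg c y"
  by (induction c arbitrary: x y) (auto simp: algebra_simps add_divide_distrib)

lemma antichain_avg_scaleR: "antichain_avg c (r *\<^sub>R x) = r * antichain_avg c x"
  by (induction c arbitrary: x) (auto simp: algebra_simps add_divide_distrib)

lemma abs_antichain_avg_le: "\<bar>antichain_avg c x\<bar> \<le> norm x"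
proof (induction c arbitrary: x)
  case (Root p)
  have "\<bar>entry x []\<bar> \<le> norm x"
    using norm_child_le[of True x] norm_ge_zero[of "child True x"] by linarith
  then show ?case by (simp add: sign_def)
next
  case (Split c d)
  show ?case
    using Split.IH(1)[of "child True x"] Split.IH(2)[of "child False x"]
      norm_child_le[of True x] norm_child_le[of False x] by simp
qed

lemma bounded_linear_antichain_avg: "bounded_linear (antichain_avg c)"
  by (rule bounded_linear_intro[of _ 1])
    (use abs_antichain_avg_le in \<open>auto simp: antichain_avg_add antichain_avg_scaleR\<close>)

text \<open>The induction needs the radius \<open>r\<close>: below a root entry of size \<open>a\<close> both subtrees live in
  the ball of radius \<open>r - a\<close> rather than in the unit ball. At a split, each half has deficit at
  most twice the total deficit because the other half contributes a nonnegative deficit to the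
  average, and the root entry is bounded by the total deficit because the average is at most the
  larger of the two subtree norms.\<close>

lemma antichain_vec_sharply_exposed:
  "\<exists>K>0. \<forall>x r. norm x \<le> r \<longrightarrow>
     norm (x - r *\<^sub>R antichain_vec c) \<le> K * (r - antichain_avg c x)"
proof (induction c)
  case (Root p)
  have "norm (x - r *\<^sub>R antichain_vec (Root p)) \<le> 2 * (r - antichain_avg (Root p) x)"
    if "norm x \<le> r" for x r
  proof -
    have "norm (child True x) \<le> r - \<bar>entry x []\<bar>" "norm (child False x) \<le> r - \<bar>entry x []\<bar>"
      using that norm_child_le[of True x] norm_child_le[of False x] by linarith+
    moreover from this have "\<bar>entry x []\<bar> \<le> r"
      using norm_ge_zero[of "child True x"] by linarith
    ultimately show ?thesis
      by (subst norm_eq_root_plus_max_child) (cases p; auto simp: sign_def)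
  qed
  then show ?case by (intro exI[of _ 2]) auto
next
  case (Split c d)
  from Split.IH obtain K L where "K > 0" "L > 0"
    and K: "\<And>x r. norm x \<le> r \<Longrightarrow> norm (x - r *\<^sub>R antichain_vec c) \<le> K * (r - antichain_avg c x)"
    and L: "\<And>x r. norm x \<le> r \<Longrightarrow> norm (x - r *\<^sub>R antichain_vec d) \<le> L * (r - antichain_avg d x)"
    by blast
  let ?M = "1 + 2 * max K L"
  have "norm (x - r *\<^sub>R antichain_vec (Split c d)) \<le> ?M * (r - antichain_avg (Split c d) x)"
    if x: "norm x \<le> r" for x r
  proof -
    let ?y = "child True x" and ?z = "child False x"
    let ?e = "r - antichain_avg (Split c d) x"
    have y: "norm ?y \<le> r - \<bar>entry x []\<bar>" and z: "norm ?z \<le> r - \<bar>entry x []\<bar>"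
      using x norm_child_le[of True x] norm_child_le[of False x] by auto
    have avg: "antichain_avg c ?y \<le> norm ?y" "antichain_avg d ?z \<le> norm ?z"
      using abs_antichain_avg_le abs_le_D1 by blast+
    then have gaps: "0 \<le> r - antichain_avg c ?y" "r - antichain_avg c ?y \<le> 2 * ?e"
        "0 \<le> r - antichain_avg d ?z" "r - antichain_avg d ?z \<le> 2 * ?e" "\<bar>entry x []\<bar> \<le> ?e"
      using y z by (simp_all add: field_simps)
    have "norm (?y - r *\<^sub>R antichain_vec c) \<le> K * (r - antichain_avg c ?y)"
      using K y by auto
    also have "\<dots> \<le> max K L * (2 * ?e)"
      using gaps \<open>K > 0\<close> by (intro mult_mono) auto
    finally have 1: "norm (?y - r *\<^sub>R antichain_vec c) \<le> max K L * (2 * ?e)" .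
    have "norm (?z - r *\<^sub>R antichain_vec d) \<le> L * (r - antichain_avg d ?z)"
      using L z by auto
    also have "\<dots> \<le> max K L * (2 * ?e)"
      using gaps \<open>K > 0\<close> by (intro mult_mono) auto
    finally have 2: "norm (?z - r *\<^sub>R antichain_vec d) \<le> max K L * (2 * ?e)" .
    have "norm (x - r *\<^sub>R antichain_vec (Split c d)) \<le> ?e + max K L * (2 * ?e)"
      by (subst norm_eq_root_plus_max_child) (use 1 2 gaps(5) in auto)
    also have "?e + max K L * (2 * ?e) = ?M * ?e" by (simp only: distrib_right distrib_left mult_1 mult_1_right mult_ac)
    finally show ?thesis .
  qed
  moreover have "?M > 0" using \<open>K > 0\<close> by auto
  ultimately show ?case by blast
qed

text \<open>The \<open>\<ell>\<^sub>\<infinity>\<close>-step: the convex hull of a product is the product of the convex hulls, and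
  joining two subtrees is linear and maps pairs of antichains to antichains.\<close>

lemma node_mem_convex_hull:
  assumes "x \<in> convex hull range antichain_vec" "y \<in> convex hull range antichain_vec"
  shows "node 0 x y \<in> convex hull range antichain_vec"
proof -
  let ?j = "\<lambda>p. node 0 (fst p) (snd p)"
  have "linear ?j"
  proof (rule linearI)
    show "?j (p + q) = ?j p + ?j q" for p q
      by (rule trans[OF _ node_collapse]) simp
    show "?j (r *\<^sub>R p) = r *\<^sub>R ?j p" for r p
      by (rule trans[OF _ node_collapse]) simp
  qed
  then have "?j ` (convex hull (range antichain_vec \<times> range antichain_vec))
      = convex hull (?j ` (range antichain_vec \<times> range antichain_vec))"
    by (rule convex_hull_linear_image)
  also have "\<dots> \<subseteq> convex hull range antichain_vec"
  proof (rule hull_mono)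
    show "?j ` (range antichain_vec \<times> range antichain_vec) \<subseteq> range antichain_vec"
      using antichain_vec.simps(2) by (auto simp flip: antichain_vec.simps(2))
  qed
  finally show ?thesis using assms by (auto simp: convex_hull_Times image_subset_iff)
qed

text \<open>Induction on the height of the support. With \<open>a\<close> the size of the root entry, \<open>x\<close> is the
  convex combination, with weights \<open>a\<close> and \<open>1 - a\<close>, of a signed root and of a vector that joins
  the two subtrees rescaled to the unit ball.\<close>

lemma c00_ball_subset_convex_hull:
  assumes "norm x \<le> 1"
  shows "x \<in> convex hull range antichain_vec"
proof -
  have "x \<in> convex hull range antichain_vec"
    if "\<And>t. entry x t \<noteq> 0 \<Longrightarrow> length t < n" "norm x \<le> 1" for n
    using that
  proof (induction n arbitrary: x)
    let ?H = "convex hull range antichain_vec"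
    have H: "antichain_vec c \<in> ?H" for c by (simp add: hull_inc)
    \<comment> \<open>The origin is the midpoint of the two signed roots.\<close>
    have H0: "0 \<in> ?H"
    proof -
      have "(1/2) *\<^sub>R antichain_vec (Root True) + (1/2) *\<^sub>R antichain_vec (Root False) \<in> ?H"
        by (rule convexD[OF convex_convex_hull H H]) auto
      also have "(1/2) *\<^sub>R antichain_vec (Root True) + (1/2) *\<^sub>R antichain_vec (Root False) = 0"
        by (rule trans[OF node_collapse[symmetric]], rule trans[OF _ node_collapse])
          (simp add: sign_def)
      finally show ?thesis .
    qed
    {
      case 0
      then have "x = 0" by (intro c00_tree_eqI) auto
      then show ?case using H0 by simp
    next
      case (Suc n)
      define a where "a = \<bar>entry x []\<bar>"
      have norm_child: "norm (child b x) \<le> 1 - a" for b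
        using norm_child_le[of b x] Suc.prems(2) by (simp add: a_def)
      have a: "0 \<le> a" "a \<le> 1"
        using norm_child[of True] norm_ge_zero[of "child True x"] by (simp add: a_def, linarith)
      define u where "u b = inverse (1 - a) *\<^sub>R child b x" for b
      \<comment> \<open>For \<open>a = 1\<close> both subtrees vanish, in agreement with \<open>inverse 0 = 0\<close>.\<close>
      have u: "(1 - a) *\<^sub>R u b = child b x" for b
        using norm_child[of b] by (cases "a = 1") (auto simp: u_def)
      have "u b \<in> ?H" for b
      proof (rule Suc.IH)
        show "length t < n" if "entry (u b) t \<noteq> 0" for t
          using Suc.prems(1)[of "b # t"] that by (simp add: u_def)
        show "norm (u b) \<le> 1"
          using norm_child[of b] a by (cases "a = 1") (auto simp: u_def field_simps)
      qed
      then have "node 0 (u True) (u False) \<in> ?H" by (simp add: node_mem_convex_hull)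
      then have "a *\<^sub>R antichain_vec (Root (entry x [] \<ge> 0))
          + (1 - a) *\<^sub>R node 0 (u True) (u False) \<in> ?H"
        using a by (intro convexD[OF convex_convex_hull H]) auto
      also have "a *\<^sub>R antichain_vec (Root (entry x [] \<ge> 0))
          + (1 - a) *\<^sub>R node 0 (u True) (u False) = x"
        by (rule trans[OF node_collapse[symmetric]], rule trans[OF _ node_collapse])
          (simp add: u, simp add: a_def sign_def)
      finally show ?case .
    }
  qed
  moreover have "\<exists>n. \<forall>t. entry x t \<noteq> 0 \<longrightarrow> length t < n"
    using finite_nat_set_iff_bounded[of "length ` {t. entry x t \<noteq> 0}"] finite_support_entry[of x]
    by auto
  ultimately show ?thesis using assms by blast
qed

section \<open>The unit ball of the binary tree space\<close>

lemma completed_antichain_vec_sharply_exposed: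
  obtains f :: "binary_tree_space \<Rightarrow>\<^sub>L real" and K :: real where "K > 0"
    "\<And>y. norm y \<le> 1 \<Longrightarrow> norm (y - to_completion (antichain_vec c))
       \<le> K * (f (to_completion (antichain_vec c)) - f y)"
proof -
  let ?v = "to_completion (antichain_vec c)"
  obtain K where "K > 0"
    and K: "\<And>x r. norm x \<le> r \<Longrightarrow> norm (x - r *\<^sub>R antichain_vec c) \<le> K * (r - antichain_avg c x)"
    using antichain_vec_sharply_exposed by blast
  obtain f :: "binary_tree_space \<Rightarrow>\<^sub>L real"
    where f: "\<And>a. f (to_completion a) = antichain_avg c a"
    using functional_extends_to_completion[of "Blinfun (antichain_avg c)"]
      bounded_linear_Blinfun_apply[OF bounded_linear_antichain_avg] by auto
  let ?C = "{y. norm (y - ?v) \<le> K * (f ?v - f y)}"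
  have "norm (to_completion x - ?v) \<le> K * (f ?v - f (to_completion x))" if "norm x \<le> 1" for x
    using K[OF that]
    by (simp add: f antichain_avg_antichain_vec norm_to_completion flip: to_completion_diff)
  then have "to_completion ` cball 0 1 \<subseteq> ?C" by auto
  moreover have "closed ?C" by (intro closed_Collect_le continuous_intros)
  ultimately have "cball 0 1 \<subseteq> ?C"
    using completion_cball_subset_closure closure_minimal by blast
  then show ?thesis using that[OF \<open>K > 0\<close>, of f] by (auto simp: subset_iff)
qed

lemma cball_subset_closure_convex_hull_antichains:
  "cball (0 :: binary_tree_space) 1
     \<subseteq> closure (convex hull (range (\<lambda>c. to_completion (antichain_vec c))))"
proof -
  have "to_completion ` cball 0 1 \<subseteq> to_completion ` (convex hull range antichain_vec)"
    by (intro image_mono subsetI c00_ball_subset_convex_hull) simp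
  also have "\<dots> = convex hull (to_completion ` range antichain_vec)"
    by (rule convex_hull_linear_image[OF linear_to_completion])
  also have "to_completion ` range antichain_vec = range (\<lambda>c. to_completion (antichain_vec c))"
    by (rule image_image)
  finally show ?thesis
    using completion_cball_subset_closure closure_mono by blast
qed

theorem corollary3p4:
  shows "generating (cball (0 :: binary_tree_space) 1)
           {x. strongly_exposed (cball (0 :: binary_tree_space) 1) x}
         \<and> dentable (cball (0 :: binary_tree_space) 1)
         \<and> SCD (cball (0 :: binary_tree_space) 1)"
proof -
  let ?B = "cball (0 :: binary_tree_space) 1"
  let ?P = "range (\<lambda>c. to_completion (antichain_vec c))"
  have in_ball: "to_completion (antichain_vec c) \<in> ?B" for c
    by (simp add: norm_to_completion norm_antichain_vec)
  have exposed: "strongly_exposed ?B x" and denting: "denting ?B x" if "x \<in> ?P" for x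
  proof -
    from that obtain c where x: "x = to_completion (antichain_vec c)" by blast
    obtain f :: "binary_tree_space \<Rightarrow>\<^sub>L real" and K where "K > 0"
      "\<And>y. y \<in> ?B \<Longrightarrow> norm (y - x) \<le> K * (f x - f y)"
      using completed_antichain_vec_sharply_exposed[of c] unfolding x mem_cball_0 by metis
    then show "strongly_exposed ?B x" "denting ?B x"
      using in_ball x sharp_exposure_imp_strongly_exposed sharp_exposure_imp_denting by blast+
  qed
  have hull: "?B \<subseteq> closure (convex hull G)" if "?P \<subseteq> G" for G
    using cball_subset_closure_convex_hull_antichains closure_mono[OF hull_mono[OF that]] by blast
  have "generating ?B {x. strongly_exposed ?B x}"
    unfolding generating_def using exposed
    by (intro conjI hull) (auto simp: strongly_exposed_def)
  moreover have "dentable ?B"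
    unfolding dentable_def generating_def using denting
    by (intro conjI hull) (auto simp: denting_def)
  moreover have "SCD ?B"
    using denting hull[OF order_refl]
    by (intro countable_denting_generating_imp_SCD[of _ ?P]) auto
  ultimately show ?thesis by blast
qed

end
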